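(* Let $M$ be a commutative monoid. A weak ideal system on $M$ is equivalently a nucleus $r$ on $2^{M_0}$ such that $\{0\}^r = \emptyset^r$ and $\{1\}^r = M_0$. Moreover, a weak ideal system $r$ on $M$ is an ideal system on $M$ if and only if every singleton in $2^{M_0}$ is transportable through $r$.
   Context: For a commutative monoid $M$ (written multiplicatively, identity $1$), $M_0 = M\amalg\{0\}$ is the commutative monoid obtained by adjoining an element $0$ with $0x=0=x0$ for all $x\in M_0$. $2^{M_0}$ is the power set of $M_0$, ordered by inclusion, with multiplication $XY=\{xy: x\in X, y\in Y\}$; $cX=\{cx : x\in X\}$. A closure operation on a poset is a self-map $r: X\mapsto X^r$ that is expansive, order-preserving and idempotent. A nucleus on $2^{M_0}$ is a closure operation $r$ with $X^rY^r\subseteq (XY)^r$ for all $X,Y$. A weak ideal system on $M$ is a closure operation $r$ on $2^{M_0}$ such that $0\in\emptyset^r$, $cM_0\subseteq\{c\}^r$, and $cX^r\subseteq (cX)^r$ for all $c\in M_0$ and all $X\in 2^{M_0}$. A weak ideal system is an ideal system if $(cX)^r=cX^r$ for all $c\in M_0$ and all $X\in 2^{M_0}$. For a self-map $r$ of a magma $N$, an element $a\in N$ is transportable through $r$ if $(ax)^r=ax^r$ and $(xa)^r=x^ra$ for all $x\in N$. *)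

theory Defs
  imports Main "HOL-Library.Set_Algebras"
begin

datatype 'a adjoin_zero = Zero | Elem 'a

instantiation adjoin_zero :: (comm_monoid_mult) "{comm_monoid_mult, mult_zero}"
begin

definition zero_adjoin_zero :: "'a adjoin_zero" where
  "0 = Zero"

definition one_adjoin_zero :: "'a adjoin_zero" where
  "1 = Elem 1"

fun times_adjoin_zero :: "'a adjoin_zero \<Rightarrow> 'a adjoin_zero \<Rightarrow> 'a adjoin_zero" where
  "Elem x * Elem y = Elem (x * y)"
| "Zero * y = Zero"
| "Elem x * Zero = Zero"

instance
proof
  fix x y z :: "'a adjoin_zero"
  show "(x * y) * z = x * (y * z)"
    by (cases x; cases y; cases z) (simp_all add: mult.assoc)
  show "x * y = y * x"
    by (cases x; cases y) (simp_all add: mult.commute)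
  show "1 * x = x"
    by (cases x) (simp_all add: one_adjoin_zero_def)
  show "0 * x = 0"
    by (simp add: zero_adjoin_zero_def)
  show "x * 0 = 0"
    by (cases x) (simp_all add: zero_adjoin_zero_def)
qed

end

text \<open>On sets, \<open>*\<close> is the elementwise product and \<open>c *o X\<close> is the translate
  \<open>{c * x | x. x \<in> X}\<close>, both as in \<^theory>\<open>HOL-Library.Set_Algebras\<close>;
  in particular a product with an empty factor is empty.\<close>

definition closure_operation :: "('a::order \<Rightarrow> 'a) \<Rightarrow> bool" where
  "closure_operation r \<longleftrightarrow> (\<forall>x. x \<le> r x) \<and> mono r \<and> (\<forall>x. r (r x) = r x)"

definition nucleus :: "('a::{order, times} \<Rightarrow> 'a) \<Rightarrow> bool" where
  "nucleus r \<longleftrightarrow> closure_operation r \<and> (\<forall>x y. r x * r y \<le> r (x * y))"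

definition transportable :: "('a::times \<Rightarrow> 'a) \<Rightarrow> 'a \<Rightarrow> bool" where
  "transportable r a \<longleftrightarrow> (\<forall>x. r (a * x) = a * r x \<and> r (x * a) = r x * a)"

definition weak_ideal_system ::
  "('m::comm_monoid_mult adjoin_zero set \<Rightarrow> 'm adjoin_zero set) \<Rightarrow> bool" where
  "weak_ideal_system r \<longleftrightarrow>
     closure_operation r \<and>
     0 \<in> r {} \<and>
     (\<forall>c. c *o UNIV \<subseteq> r {c}) \<and>
     (\<forall>c X. c *o r X \<subseteq> r (c *o X))"

definition ideal_system ::
  "('m::comm_monoid_mult adjoin_zero set \<Rightarrow> 'm adjoin_zero set) \<Rightarrow> bool" where
  "ideal_system r \<longleftrightarrow> weak_ideal_system r \<and> (\<forall>c X. r (c *o X) = c *o r X)"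

end

theory Submission
  imports Defs
begin

text \<open>A translate is a product with a singleton, and every product is a union of translates.
  Hence, for a closure operation, the translate axiom and the nucleus inequality imply each other
  (\<open>nucleusI_translates\<close>, \<open>nucleus_translate_subset\<close>). The other two
  axioms become the two equations: \<open>0 \<in> r {}\<close> means \<open>r {0} = r {}\<close>,
  and, given the translate axiom, \<open>c *o UNIV \<subseteq> r {c}\<close> for all
  \<open>c\<close> reduces to \<open>c = 1\<close>. Transportability of \<open>{c}\<close> is the
  ideal system equation for \<open>c\<close>, its left and right versions agreeing by
  commutativity.\<close>

lemma elt_set_times_conv_singleton: "c *o X = {c} * X"
  by (auto simp: elt_set_times_def set_times_def)

lemma closure_operation_le_iff:
  assumes "closure_operation r"
  shows "r x \<le> r y \<longleftrightarrow> x \<le> r y"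
proof
  assume "x \<le> r y"
  moreover have "mono r"
    using assms by (simp add: closure_operation_def)
  ultimately have "r x \<le> r (r y)"
    by (rule monoD[rotated])
  then show "r x \<le> r y"
    using assms by (simp add: closure_operation_def)
next
  assume "r x \<le> r y"
  then show "x \<le> r y"
    using assms by (meson closure_operation_def order_trans)
qed

text \<open>Gluing the translates by elements of \<open>X\<close> handles a closure on one factor
  only (\<open>half\<close>). Two closed factors are then treated one at a time, with commutativity
  exchanging their roles.\<close>

lemma nucleusI_translates:
  fixes r :: "'a::comm_monoid_mult set \<Rightarrow> 'a set"
  assumes cl: "closure_operation r"
    and translate: "\<And>c X. c *o r X \<subseteq> r (c *o X)"
  shows "nucleus r"
proof -
  have mono: "r A \<subseteq> r B" if "A \<subseteq> B" for A B
    using cl that by (simp add: closure_operation_def mono_def)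
  have half: "X * r Y \<subseteq> r (X * Y)" for X Y
  proof
    fix z assume "z \<in> X * r Y"
    then obtain x y where x: "x \<in> X" and "y \<in> r Y" and "z = x * y"
      by (auto simp: set_times_def)
    then have "z \<in> r (x *o Y)"
      using translate[of x Y] by (auto simp: elt_set_times_def)
    also have "\<dots> \<subseteq> r (X * Y)"
      using x by (intro mono) (auto simp: elt_set_times_def set_times_def)
    finally show "z \<in> r (X * Y)" .
  qed
  have "r X * r Y \<subseteq> r (X * Y)" for X Y
  proof -
    have "r X * r Y \<subseteq> r (r X * Y)"
      by (rule half)
    also have "r X * Y \<subseteq> r (X * Y)"
      using half[of Y X] by (simp add: mult.commute)
    \<comment> \<open>The target is already closed, so applying \<open>r\<close> a second time costs
      nothing.\<close>
    then have "r (r X * Y) \<subseteq> r (X * Y)"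
      using cl by (simp add: closure_operation_le_iff)
    finally show ?thesis .
  qed
  with cl show ?thesis
    by (simp add: nucleus_def)
qed

text \<open>Expansiveness puts \<open>{c}\<close> inside \<open>r {c}\<close>, so the translate lies
  in the product of closures that the nucleus inequality bounds.\<close>

lemma nucleus_translate_subset:
  fixes r :: "'a::times set \<Rightarrow> 'a set"
  assumes "nucleus r"
  shows "c *o r X \<subseteq> r (c *o X)"
proof -
  have "{c} \<subseteq> r {c}" and "r {c} * r X \<subseteq> r ({c} * X)"
    using assms by (auto simp: nucleus_def closure_operation_def)
  then show ?thesis
    unfolding elt_set_times_conv_singleton by (auto simp: set_times_def)
qed

lemma weak_ideal_system_iff_nucleus:
  "weak_ideal_system r \<longleftrightarrow> nucleus r \<and> r {0} = r {} \<and> r {1} = UNIV"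
proof (intro iffI conjI)
  assume w: "weak_ideal_system r"
  then have cl: "closure_operation r"
    by (simp add: weak_ideal_system_def)
  show "nucleus r"
    using w by (intro nucleusI_translates) (auto simp: weak_ideal_system_def)
  show "r {0} = r {}"
  proof (rule antisym)
    show "r {0} \<subseteq> r {}"
      using w closure_operation_le_iff[OF cl] by (simp add: weak_ideal_system_def)
    show "r {} \<subseteq> r {0}"
      using closure_operation_le_iff[OF cl] by simp
  qed
  have "1 *o UNIV \<subseteq> r {1}"
    using w by (simp only: weak_ideal_system_def)
  then show "r {1} = UNIV"
    by (auto simp: elt_set_times_def)
next
  assume "nucleus r \<and> r {0} = r {} \<and> r {1} = UNIV"
  then have n: "nucleus r" and zero: "r {0} = r {}" and one: "r {1} = UNIV"
    by simp_all
  then have cl: "closure_operation r"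
    by (simp add: nucleus_def)
  then have "{0} \<subseteq> r {0}"
    by (simp add: closure_operation_def)
  \<comment> \<open>Translating \<open>r {1} = UNIV\<close> by \<open>c\<close> suffices, since
    \<open>c *o {1} = {c}\<close>.\<close>
  moreover have "c *o UNIV \<subseteq> r {c}" for c
    using nucleus_translate_subset[OF n, of c "{1}"] one
    by (simp add: elt_set_times_def)
  ultimately show "weak_ideal_system r"
    using cl zero nucleus_translate_subset[OF n] by (simp add: weak_ideal_system_def)
qed

theorem proposition10p3:
  fixes r :: "'m::comm_monoid_mult adjoin_zero set \<Rightarrow> 'm adjoin_zero set"
  shows "(weak_ideal_system r \<longleftrightarrow> nucleus r \<and> r {0} = r {} \<and> r {1} = UNIV) \<and>
         (weak_ideal_system r \<longrightarrow> (ideal_system r \<longleftrightarrow> (\<forall>c. transportable r {c})))"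
  using weak_ideal_system_iff_nucleus[of r]
  by (simp add: ideal_system_def transportable_def elt_set_times_conv_singleton mult.commute)

end
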